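(* Let $M$ be one of the $2$-dimensional pseudo-Riemannian quadrics $S^2_1,S^2_2,H^2_0,H^2_1,H^2_2$ (i.e. any quadric other than the Riemannian $2$-sphere $S^2_0$), of sectional curvature $\epsilon=\pm1$. Then up to congruence there exists a unique non-trivial harmonic Killing field $\sigma$ on $M$, which is the restriction to $M$ of the linear map with matrix $$\begin{pmatrix}0&1&0\\\epsilon&0&0\\0&0&0\end{pmatrix},\qquad\begin{pmatrix}0&0&0\\0&0&1\\0&\epsilon&0\end{pmatrix},\qquad\begin{pmatrix}0&1&0\\-1&0&0\\0&0&0\end{pmatrix},$$ according as $M=S^2_2$ or $H^2_0$; $M=S^2_1$ or $H^2_1$; or $M=H^2_2$, respectively. In all cases the metric parameters of $\sigma$ are $(p,q)=(3,-1/2)$.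
   Context: $\mathbb{R}^3_u$ denotes $\mathbb{R}^3$ with the standard diagonal inner product of index $u$ (the last $u$ coordinates carry minus signs). $S^2_v=\{x\in\mathbb{R}^3_v:\langle x,x\rangle=1\}$ (curvature $\epsilon=1$) and $H^2_v=\{x\in\mathbb{R}^3_{v+1}:\langle x,x\rangle=-1\}$ (curvature $\epsilon=-1$), $v=0,1,2$, with induced metrics; the whole hyperquadric is taken (both components in the cases $S^2_2$, $H^2_0$). Matrices are with respect to the standard coordinates. Each Killing field on $M$ is the restriction to $M$ of a unique skew-symmetric linear map of the ambient space. Two vector fields $\sigma,\tilde\sigma$ on $M$ are congruent if $\tilde\sigma=\varphi_*\sigma$, $(\varphi_*\sigma)(x)=d\varphi(\sigma(\varphi^{-1}(x)))$, for some isometry $\varphi$ of $M$. Let $\sigma$ be a vector field on a pseudo-Riemannian manifold $(M,g=\langle\cdot,\cdot\rangle)$ with Levi-Civita connection $\nabla$, $F=\frac12\langle\sigma,\sigma\rangle$, $\nabla F=\operatorname{grad}F$, $\Delta F=-\operatorname{div}\nabla F$. For a local orthonormal frame $\{E_i\}$ with $\epsilon_i=\langle E_i,E_i\rangle=\pm1$ put $\langle\nabla\sigma,\nabla\sigma\rangle=\sum_i\epsilon_i\langle\nabla_{E_i}\sigma,\nabla_{E_i}\sigma\rangle$ and $\nabla^*\nabla\sigma=-\sum_i\epsilon_i\nabla^2_{E_i,E_i}\sigma$. Then $\sigma$ is $(p,q)$-harmonic if $\tau_{p,q}(\sigma)=0$ identically on $M$, where $$\tau_{p,q}(\sigma)=(1+2F)\nabla^*\nabla\sigma+2p\nabla_{\nabla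 F}\sigma-\bigl(p\langle\nabla\sigma,\nabla\sigma\rangle-pq\,g(\nabla F,\nabla F)-q(1+2F)\Delta F\bigr)\sigma ;$$ $\sigma$ is a harmonic vector field if it is $(p,q)$-harmonic for some $(p,q)\in\mathbb{R}^2$, and such $(p,q)$ are called metric parameters of $\sigma$. *)

theory Defs
  imports "HOL-Analysis.Analysis"
begin

text \<open>The last \<open>u\<close> of the three coordinates carry the minus sign.\<close>

definition coord_sign :: "nat \<Rightarrow> nat \<Rightarrow> real" where
  "coord_sign u i = (if i + u \<le> 3 then 1 else -1)"

definition sprod :: "nat \<Rightarrow> real^3 \<Rightarrow> real^3 \<Rightarrow> real" where
  "sprod u x y =
     coord_sign u 1 * x$1 * y$1 + coord_sign u 2 * x$2 * y$2 + coord_sign u 3 * x$3 * y$3"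

datatype quadric = S2 nat | H2 nat

primrec ambient_index :: "quadric \<Rightarrow> nat" where
  "ambient_index (S2 v) = v"
| "ambient_index (H2 v) = v + 1"

primrec curv :: "quadric \<Rightarrow> real" where
  "curv (S2 v) = 1"
| "curv (H2 v) = -1"

abbreviation qmetric :: "quadric \<Rightarrow> real^3 \<Rightarrow> real^3 \<Rightarrow> real" where
  "qmetric M \<equiv> sprod (ambient_index M)"

definition points :: "quadric \<Rightarrow> (real^3) set" where
  "points M = {x. qmetric M x x = curv M}"

definition tangent :: "quadric \<Rightarrow> real^3 \<Rightarrow> (real^3) set" where
  "tangent M x = {v. qmetric M v x = 0}"

text \<open>Orthogonal projection of the ambient space onto the tangent space at a point of the
  quadric; the position vector is normal there, of square \<open>curv M = \<plusminus>1\<close>.\<close>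

definition tan_proj :: "quadric \<Rightarrow> real^3 \<Rightarrow> real^3 \<Rightarrow> real^3" where
  "tan_proj M x w = w - (curv M * qmetric M w x) *\<^sub>R x"

text \<open>\<open>C\<^sup>k\<close> on an open set \<open>U\<close>.\<close>

primrec Ck_on :: "nat \<Rightarrow> (real^3 \<Rightarrow> real^3) \<Rightarrow> (real^3) set \<Rightarrow> bool" where
  "Ck_on 0 f U \<longleftrightarrow> continuous_on U f"
| "Ck_on (Suc k) f U \<longleftrightarrow>
     f differentiable_on U \<and> (\<forall>v. Ck_on k (\<lambda>x. frechet_derivative f (at x) v) U)"

text \<open>Smoothness on the submanifold: locally the restriction of an ambient
  \<open>C\<^sup>\<infinity>\<close> map. Only the values of \<open>f\<close> on the quadric matter.\<close>

definition smooth_on_quadric :: "quadric \<Rightarrow> (real^3 \<Rightarrow> real^3) \<Rightarrow> bool" where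
  "smooth_on_quadric M f \<longleftrightarrow>
     (\<forall>x\<in>points M. \<exists>U g. open U \<and> x \<in> U \<and> (\<forall>k. Ck_on k g U) \<and> (\<forall>y\<in>U \<inter> points M. g y = f y))"

definition vector_field :: "quadric \<Rightarrow> (real^3 \<Rightarrow> real^3) \<Rightarrow> bool" where
  "vector_field M \<sigma> \<longleftrightarrow> smooth_on_quadric M \<sigma> \<and> (\<forall>x\<in>points M. \<sigma> x \<in> tangent M x)"

text \<open>The differential at \<open>x\<close>, applied to \<open>v\<close>, of a map defined on the quadric. A derivative
  within the quadric is not unique as a linear map on the ambient space, but its values on
  tangent vectors are; see \<open>dir_deriv_eq\<close> below.\<close>

definition dir_deriv ::
    "quadric \<Rightarrow> (real^3 \<Rightarrow> 'b::real_normed_vector) \<Rightarrow> real^3 \<Rightarrow> real^3 \<Rightarrow> 'b" where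
  "dir_deriv M f x v = (THE d. \<exists>f'. (f has_derivative f') (at x within points M) \<and> f' v = d)"

text \<open>The Levi-Civita connection \<open>\<nabla>\<^sub>v \<sigma>\<close> at \<open>x\<close> as the tangential part of the flat ambient
  derivative. See \<open>cov_metric\<close> and \<open>cov_torsion_free\<close> below; the right-hand side of the
  latter is the Lie bracket \<open>[X, Y]\<close>, computed in the ambient space.\<close>

definition cov :: "quadric \<Rightarrow> (real^3 \<Rightarrow> real^3) \<Rightarrow> real^3 \<Rightarrow> real^3 \<Rightarrow> real^3" where
  "cov M \<sigma> x v = tan_proj M x (dir_deriv M \<sigma> x v)"

text \<open>\<open>\<nabla>\<^sup>2\<^sub>v\<^sub>,\<^sub>w \<sigma> = \<nabla>\<^sub>v \<nabla>\<^sub>W \<sigma> - \<nabla>\<^bsub>\<nabla>\<^sub>v W\<^esub> \<sigma>\<close> at \<open>x\<close>, where the tangent vector \<open>w\<close> is extended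
  to the tangent field \<open>W = (\<lambda>y. tan_proj M y w)\<close>. The expression is tensorial in \<open>W\<close>, so the
  choice of extension is immaterial.\<close>

definition cov2 :: "quadric \<Rightarrow> (real^3 \<Rightarrow> real^3) \<Rightarrow> real^3 \<Rightarrow> real^3 \<Rightarrow> real^3 \<Rightarrow> real^3" where
  "cov2 M \<sigma> x v w =
     (let W = (\<lambda>y. tan_proj M y w)
      in cov M (\<lambda>y. cov M \<sigma> y (W y)) x v - cov M \<sigma> x (cov M W x v))"

definition orthonormal_basis :: "quadric \<Rightarrow> real^3 \<Rightarrow> (real^3) \<times> (real^3) \<Rightarrow> bool" where
  "orthonormal_basis M x = (\<lambda>(e1, e2).
     e1 \<in> tangent M x \<and> e2 \<in> tangent M x \<and> qmetric M e1 e2 = 0 \<and>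
     qmetric M e1 e1 \<in> {1, -1} \<and> qmetric M e2 e2 \<in> {1, -1})"

text \<open>\<open>\<Sum>\<^sub>i \<epsilon>\<^sub>i B(E\<^sub>i, E\<^sub>i)\<close> for an orthonormal basis of the tangent space at \<open>x\<close>; a basis exists
  by \<open>orthonormal_basis_exists\<close> and the value does not depend on it by \<open>metric_trace_eq\<close>.\<close>

definition metric_trace ::
    "quadric \<Rightarrow> real^3 \<Rightarrow> (real^3 \<Rightarrow> real^3 \<Rightarrow> 'b::real_vector) \<Rightarrow> 'b" where
  "metric_trace M x B =
     (let (e1, e2) = (SOME e. orthonormal_basis M x e)
      in qmetric M e1 e1 *\<^sub>R B e1 e1 + qmetric M e2 e2 *\<^sub>R B e2 e2)"

definition grad :: "quadric \<Rightarrow> (real^3 \<Rightarrow> real) \<Rightarrow> real^3 \<Rightarrow> real^3" where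
  "grad M f x =
     (THE g. g \<in> tangent M x \<and> (\<forall>v\<in>tangent M x. qmetric M g v = dir_deriv M f x v))"

definition divergence :: "quadric \<Rightarrow> (real^3 \<Rightarrow> real^3) \<Rightarrow> real^3 \<Rightarrow> real" where
  "divergence M X x = metric_trace M x (\<lambda>v w. qmetric M (cov M X x v) w)"

definition laplacian :: "quadric \<Rightarrow> (real^3 \<Rightarrow> real) \<Rightarrow> real^3 \<Rightarrow> real" where
  "laplacian M f x = - divergence M (grad M f) x"

definition rough_laplacian :: "quadric \<Rightarrow> (real^3 \<Rightarrow> real^3) \<Rightarrow> real^3 \<Rightarrow> real^3" where
  "rough_laplacian M \<sigma> x = - metric_trace M x (cov2 M \<sigma> x)"

definition cov_norm2 :: "quadric \<Rightarrow> (real^3 \<Rightarrow> real^3) \<Rightarrow> real^3 \<Rightarrow> real" where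
  "cov_norm2 M \<sigma> x = metric_trace M x (\<lambda>v w. qmetric M (cov M \<sigma> x v) (cov M \<sigma> x w))"

definition energy :: "quadric \<Rightarrow> (real^3 \<Rightarrow> real^3) \<Rightarrow> real^3 \<Rightarrow> real" where
  "energy M \<sigma> x = qmetric M (\<sigma> x) (\<sigma> x) / 2"

definition tau :: "quadric \<Rightarrow> real \<Rightarrow> real \<Rightarrow> (real^3 \<Rightarrow> real^3) \<Rightarrow> real^3 \<Rightarrow> real^3" where
  "tau M p q \<sigma> x =
     (let F = energy M \<sigma>; G = grad M F
      in (1 + 2 * F x) *\<^sub>R rough_laplacian M \<sigma> x
         + (2 * p) *\<^sub>R cov M \<sigma> x (G x)
         - (p * cov_norm2 M \<sigma> x - p * q * qmetric M (G x) (G x)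
            - q * (1 + 2 * F x) * laplacian M F x) *\<^sub>R \<sigma> x)"

definition pq_harmonic :: "quadric \<Rightarrow> real \<Rightarrow> real \<Rightarrow> (real^3 \<Rightarrow> real^3) \<Rightarrow> bool" where
  "pq_harmonic M p q \<sigma> \<longleftrightarrow> vector_field M \<sigma> \<and> (\<forall>x\<in>points M. tau M p q \<sigma> x = 0)"

definition metric_parameters :: "quadric \<Rightarrow> (real^3 \<Rightarrow> real^3) \<Rightarrow> (real \<times> real) set" where
  "metric_parameters M \<sigma> = {(p, q). pq_harmonic M p q \<sigma>}"

definition harmonic_field :: "quadric \<Rightarrow> (real^3 \<Rightarrow> real^3) \<Rightarrow> bool" where
  "harmonic_field M \<sigma> \<longleftrightarrow> (\<exists>p q. pq_harmonic M p q \<sigma>)"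

definition nontrivial :: "quadric \<Rightarrow> (real^3 \<Rightarrow> real^3) \<Rightarrow> bool" where
  "nontrivial M \<sigma> \<longleftrightarrow> (\<exists>x\<in>points M. \<sigma> x \<noteq> 0)"

definition skew_symmetric :: "quadric \<Rightarrow> real^3^3 \<Rightarrow> bool" where
  "skew_symmetric M A \<longleftrightarrow> (\<forall>v w. qmetric M (A *v v) w = - qmetric M v (A *v w))"

text \<open>Besides Killing's equation, a Killing field is required to be the restriction of a
  skew-symmetric linear map. On a connected quadric this follows from the equation. On the
  two-sheeted ones, \<open>S2 2\<close> and \<open>H2 0\<close>, it is a convention: it excludes fields that are given
  by unrelated linear maps on the two sheets.\<close>

definition killing_field :: "quadric \<Rightarrow> (real^3 \<Rightarrow> real^3) \<Rightarrow> bool" where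
  "killing_field M \<sigma> \<longleftrightarrow>
     vector_field M \<sigma> \<and>
     (\<forall>x\<in>points M. \<forall>v\<in>tangent M x. \<forall>w\<in>tangent M x.
        qmetric M (cov M \<sigma> x v) w + qmetric M v (cov M \<sigma> x w) = 0) \<and>
     (\<exists>A. skew_symmetric M A \<and> (\<forall>x\<in>points M. \<sigma> x = A *v x))"

definition isometry :: "quadric \<Rightarrow> (real^3 \<Rightarrow> real^3) \<Rightarrow> bool" where
  "isometry M \<phi> \<longleftrightarrow>
     bij_betw \<phi> (points M) (points M) \<and>
     smooth_on_quadric M \<phi> \<and> smooth_on_quadric M (inv_into (points M) \<phi>) \<and>
     (\<forall>x\<in>points M. \<forall>v\<in>tangent M x. \<forall>w\<in>tangent M x.
        qmetric M (dir_deriv M \<phi> x v) (dir_deriv M \<phi> x w) = qmetric M v w)"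

definition push_forward ::
    "quadric \<Rightarrow> (real^3 \<Rightarrow> real^3) \<Rightarrow> (real^3 \<Rightarrow> real^3) \<Rightarrow> real^3 \<Rightarrow> real^3" where
  "push_forward M \<phi> \<sigma> x =
     (let y = inv_into (points M) \<phi> x in dir_deriv M \<phi> y (\<sigma> y))"

definition congruent_fields ::
    "quadric \<Rightarrow> (real^3 \<Rightarrow> real^3) \<Rightarrow> (real^3 \<Rightarrow> real^3) \<Rightarrow> bool" where
  "congruent_fields M \<sigma> \<sigma>' \<longleftrightarrow>
     (\<exists>\<phi>. isometry M \<phi> \<and> (\<forall>x\<in>points M. \<sigma>' x = push_forward M \<phi> \<sigma> x))"

definition model_matrix :: "quadric \<Rightarrow> real^3^3" where
  "model_matrix M =
     (if M = S2 2 \<or> M = H2 0 then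
        vector [vector [0, 1, 0], vector [curv M, 0, 0], vector [0, 0, 0]]
      else if M = S2 1 \<or> M = H2 1 then
        vector [vector [0, 0, 0], vector [0, 0, 1], vector [0, curv M, 0]]
      else
        vector [vector [0, 1, 0], vector [-1, 0, 0], vector [0, 0, 0]])"


section \<open>Well-definedness of the geometric notions\<close>

lemma coord_sign_sq [simp]: "coord_sign u i * coord_sign u i = 1"
  by (simp add: coord_sign_def)

lemma curv_sq [simp]: "curv M * curv M = 1"
  by (cases M) auto

lemma sprod_commute: "sprod u x y = sprod u y x"
  by (simp add: sprod_def)

lemma bilinear_sprod: "bilinear (sprod u)"
  by (auto simp: bilinear_def sprod_def algebra_simps intro!: linearI)

lemma bounded_bilinear_sprod: "bounded_bilinear (sprod u)"
  using bilinear_sprod bilinear_conv_bounded_bilinear by blast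

lemma sprod_simps [simp]:
  "sprod u (x + y) z = sprod u x z + sprod u y z"
  "sprod u z (x + y) = sprod u z x + sprod u z y"
  "sprod u (x - y) z = sprod u x z - sprod u y z"
  "sprod u z (x - y) = sprod u z x - sprod u z y"
  "sprod u (r *\<^sub>R x) z = r * sprod u x z"
  "sprod u z (r *\<^sub>R x) = r * sprod u z x"
  "sprod u 0 z = 0" "sprod u z 0 = 0"
  by (simp_all add: sprod_def algebra_simps)

lemma sprod_nondegenerate:
  assumes "\<And>y. sprod u x y = 0"
  shows "x = 0"
proof -
  have ne: "coord_sign u i \<noteq> 0" for i
    by (simp add: coord_sign_def)
  have "x$1 = 0" "x$2 = 0" "x$3 = 0"
    using assms[of "axis 1 1"] assms[of "axis 2 1"] assms[of "axis 3 1"] ne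
    by (simp_all add: sprod_def axis_def)
  then show ?thesis
    by (simp add: vec_eq_iff forall_3)
qed

lemma tan_proj_tangent: "x \<in> points M \<Longrightarrow> tan_proj M x w \<in> tangent M x"
  by (simp add: tan_proj_def tangent_def points_def algebra_simps flip: mult.assoc)

lemma tan_proj_id: "v \<in> tangent M x \<Longrightarrow> tan_proj M x v = v"
  by (simp add: tan_proj_def tangent_def)

lemma metric_tan_proj: "v \<in> tangent M x \<Longrightarrow> qmetric M (tan_proj M x w) v = qmetric M w v"
  by (simp add: tan_proj_def tangent_def sprod_commute)

lemma curve_in_quadric:
  assumes x: "x \<in> points M" and v: "v \<in> tangent M x"
  obtains \<gamma> T where "open T" "0 \<in> T" "\<gamma> ` T \<subseteq> points M" "\<gamma> 0 = x"
    "(\<gamma> has_derivative (\<lambda>t::real. t *\<^sub>R v)) (at 0)"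
proof -
  define c where "c = curv M * qmetric M v v"
  define \<gamma> where "\<gamma> = (\<lambda>t::real. (1 / sqrt (1 + t\<^sup>2 * c)) *\<^sub>R (x + t *\<^sub>R v))"
  define T where "T = {t::real. 0 < 1 + t\<^sup>2 * c}"
  have "open T"
    unfolding T_def by (intro open_Collect_less continuous_intros)
  moreover have "0 \<in> T" "\<gamma> 0 = x"
    by (auto simp: T_def \<gamma>_def)
  moreover have "\<gamma> ` T \<subseteq> points M"
  proof
    fix y assume "y \<in> \<gamma> ` T"
    then obtain t where t: "0 < 1 + t\<^sup>2 * c" and y: "y = \<gamma> t"
      by (auto simp: T_def)
    have e: "qmetric M (x + t *\<^sub>R v) (x + t *\<^sub>R v) = curv M * (1 + t\<^sup>2 * c)"
    proof -
      have "qmetric M x x = curv M" "qmetric M v x = 0" "qmetric M x v = 0"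
        using x v by (simp_all add: points_def tangent_def sprod_commute[of _ x v])
      then have "qmetric M (x + t *\<^sub>R v) (x + t *\<^sub>R v) = curv M + t * t * qmetric M v v"
        by simp
      also have "\<dots> = curv M * (1 + t\<^sup>2 * c)"
        using curv_sq[of M] unfolding c_def power2_eq_square by algebra
      finally show ?thesis .
    qed
    have "qmetric M y y = (1 / sqrt (1 + t\<^sup>2 * c))\<^sup>2 * qmetric M (x + t *\<^sub>R v) (x + t *\<^sub>R v)"
      unfolding y \<gamma>_def by (simp add: algebra_simps power2_eq_square del: times_divide_eq_left times_divide_eq_right)
    also have "\<dots> = curv M"
      unfolding e using t by (simp add: power_divide)
    finally show "y \<in> points M"
      by (simp add: points_def)
  qed
  moreover have "(\<gamma> has_derivative (\<lambda>t::real. t *\<^sub>R v)) (at 0)"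
    unfolding \<gamma>_def by (rule derivative_eq_intros refl | simp)+
  ultimately show ?thesis
    using that by blast
qed

lemma dir_deriv_eq:
  assumes f: "(f has_derivative f') (at x within points M)"
    and x: "x \<in> points M" and v: "v \<in> tangent M x"
  shows "dir_deriv M f x v = f' v"
proof -
  obtain \<gamma> T where \<gamma>: "open T" "0 \<in> T" "\<gamma> ` T \<subseteq> points M" "\<gamma> 0 = x"
    and d\<gamma>: "(\<gamma> has_derivative (\<lambda>t::real. t *\<^sub>R v)) (at 0)"
    using curve_in_quadric[OF x v] by blast
  have comp: "((\<lambda>t. f (\<gamma> t)) has_derivative (\<lambda>t. g' (t *\<^sub>R v))) (at 0)"
    if g: "(f has_derivative g') (at x within points M)" for g'
  proof -
    have "(f has_derivative g') (at (\<gamma> 0) within \<gamma> ` T)"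
      using has_derivative_subset[OF g] \<gamma> by auto
    moreover have "(\<gamma> has_derivative (\<lambda>t::real. t *\<^sub>R v)) (at 0 within T)"
      using d\<gamma> has_derivative_at_withinI by blast
    ultimately have "((\<lambda>t. f (\<gamma> t)) has_derivative (\<lambda>t. g' (t *\<^sub>R v))) (at 0 within T)"
      by (rule has_derivative_in_compose[rotated])
    then show ?thesis
      using \<gamma> at_within_open by metis
  qed
  have "g' v = f' v" if g: "(f has_derivative g') (at x within points M)" for g'
    using fun_cong[OF has_derivative_unique[OF comp[OF g] comp[OF f]], of 1] by simp
  then have uniq: "d = f' v"
    if "\<exists>f'. (f has_derivative f') (at x within points M) \<and> f' v = d" for d
    using that by blast
  show ?thesis
    unfolding dir_deriv_def by (rule the_equality[OF _ uniq]) (use f in blast)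
qed

lemma cov_metric:
  assumes "(X has_derivative X') (at x within points M)"
    and "(Y has_derivative Y') (at x within points M)"
    and "X x \<in> tangent M x" "Y x \<in> tangent M x" "x \<in> points M" "v \<in> tangent M x"
  shows "dir_deriv M (\<lambda>y. qmetric M (X y) (Y y)) x v
       = qmetric M (cov M X x v) (Y x) + qmetric M (X x) (cov M Y x v)"
proof -
  have "((\<lambda>y. qmetric M (X y) (Y y)) has_derivative
      (\<lambda>h. qmetric M (X x) (Y' h) + qmetric M (X' h) (Y x))) (at x within points M)"
    by (rule bounded_bilinear.FDERIV[OF bounded_bilinear_sprod assms(1,2)])
  from dir_deriv_eq[OF this assms(5,6)] show ?thesis
    using assms by (simp add: cov_def dir_deriv_eq metric_tan_proj
        sprod_commute[of _ "X x" "Y' v"] sprod_commute[of _ "X x" "tan_proj M x (Y' v)"])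
qed

lemma cov_torsion_free:
  assumes X: "(X has_derivative X') (at x within points M)"
    and Y: "(Y has_derivative Y') (at x within points M)"
    and tX: "\<And>y. y \<in> points M \<Longrightarrow> X y \<in> tangent M y"
    and tY: "\<And>y. y \<in> points M \<Longrightarrow> Y y \<in> tangent M y"
    and x: "x \<in> points M"
  shows "cov M Y x (X x) - cov M X x (Y x)
       = dir_deriv M Y x (X x) - dir_deriv M X x (Y x)"
proof -
  have *: "qmetric M (Z' v) x + qmetric M (Z x) v = 0"
    if Z: "(Z has_derivative Z') (at x within points M)"
      and tZ: "\<And>y. y \<in> points M \<Longrightarrow> Z y \<in> tangent M y" and v: "v \<in> tangent M x" for Z Z' v
  proof -
    have 1: "((\<lambda>y. qmetric M (Z y) y) has_derivative
        (\<lambda>h. qmetric M (Z x) h + qmetric M (Z' h) x)) (at x within points M)"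
      by (rule bounded_bilinear.FDERIV[OF bounded_bilinear_sprod Z has_derivative_ident])
    have 2: "((\<lambda>y. qmetric M (Z y) y) has_derivative (\<lambda>h. 0)) (at x within points M)"
      by (rule has_derivative_transform[OF x _ has_derivative_const[of 0]])
        (use tZ in \<open>auto simp: tangent_def\<close>)
    show ?thesis
      using dir_deriv_eq[OF 1 x v] dir_deriv_eq[OF 2 x v] by simp
  qed
  have "qmetric M (Y' (X x)) x = qmetric M (X' (Y x)) x"
    using *[OF Y tY tX[OF x]] *[OF X tX tY[OF x]] sprod_commute by (smt (verit))
  then show ?thesis
    using X Y tX[OF x] tY[OF x] x by (simp add: cov_def dir_deriv_eq tan_proj_def)
qed

lemma orthonormal_basis_exists: "x \<in> points M \<Longrightarrow> \<exists>e. orthonormal_basis M x e"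
proof -
  assume x: "x \<in> points M"
  define u where "u = ambient_index M"
  define s where "s = coord_sign u"
  define J where "J = (\<lambda>(a :: real^3) (b :: real^3). vector [s 1 * (a$2 * b$3 - a$3 * b$2),
    s 2 * (a$3 * b$1 - a$1 * b$3), s 3 * (a$1 * b$2 - a$2 * b$1)] :: real^3)"
  define D where "D = s 1 * s 2 * s 3"
  have ss: "s 1 * s 1 = 1" "s 2 * s 2 = 1" "s 3 * s 3 = 1"
    by (simp_all add: s_def)
  have D: "D = 1 \<or> D = -1"
    by (auto simp: D_def s_def coord_sign_def)
  have Jl: "sprod u (J a b) a = 0" and Jr: "sprod u (J a b) b = 0" for a b
    using ss unfolding sprod_def s_def[symmetric] J_def by (simp_all, algebra+)
  have JJ: "sprod u (J a b) (J a b) = D * (sprod u a a * sprod u b b - (sprod u a b)\<^sup>2)" for a b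
    using ss unfolding sprod_def s_def[symmetric] J_def D_def by (simp, algebra)
  have xx: "sprod u x x = curv M"
    using x by (simp add: points_def u_def)
  have c: "curv M = 1 \<or> curv M = -1"
    by (cases M) auto
  have "\<exists>b. sprod u (J x b) (J x b) \<noteq> 0"
  proof (rule ccontr)
    assume "\<nexists>b. sprod u (J x b) (J x b) \<noteq> 0"
    then have z: "curv M * sprod u b b = (sprod u x b)\<^sup>2" for b
      using D JJ[of x b] xx by auto
    have "curv M * s 1 = (s 1 * x$1)\<^sup>2" "curv M * s 2 = (s 2 * x$2)\<^sup>2"
      "curv M * s 3 = (s 3 * x$3)\<^sup>2"
      using z[of "axis 1 1"] z[of "axis 2 1"] z[of "axis 3 1"]
      by (simp_all add: sprod_def axis_def s_def)
    then have "3 * curv M = sprod u x x"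
      using ss unfolding sprod_def s_def[symmetric] by algebra
    then show False
      using xx c by auto
  qed
  then obtain b where b: "sprod u (J x b) (J x b) \<noteq> 0"
    by blast
  define n where "n = sprod u (J x b) (J x b)"
  define e1 where "e1 = (1 / sqrt \<bar>n\<bar>) *\<^sub>R J x b"
  define e2 where "e2 = J x e1"
  have "sprod u e1 e1 = n / \<bar>n\<bar>"
    unfolding e1_def by (simp add: n_def)
  then have e11: "sprod u e1 e1 \<in> {1, -1}"
    using b by (auto simp: n_def abs_if)
  have e1x: "sprod u e1 x = 0"
    by (simp add: e1_def Jl)
  have "sprod u e2 e2 = D * (curv M * sprod u e1 e1)"
    using JJ[of x e1] e1x by (simp add: e2_def xx sprod_commute[of u x e1])
  then have e22: "sprod u e2 e2 \<in> {1, -1}"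
    using D c e11 by auto
  have "orthonormal_basis M x (e1, e2)"
    using e11 e22 e1x Jl Jr
    by (simp add: orthonormal_basis_def tangent_def u_def[symmetric] e2_def sprod_commute[of u e1 "J x e1"])
  then show ?thesis ..
qed

lemma orthonormal_expansion:
  assumes x: "x \<in> points M" and e: "orthonormal_basis M x (e1, e2)" and v: "v \<in> tangent M x"
  shows "v = (qmetric M e1 e1 * qmetric M v e1) *\<^sub>R e1 + (qmetric M e2 e2 * qmetric M v e2) *\<^sub>R e2"
proof -
  define g where "g = qmetric M"
  have c: "curv M \<noteq> 0"
    by (cases M) auto
  have g: "g e1 e1 * g e1 e1 = 1" "g e2 e2 * g e2 e2 = 1" "g e1 e2 = 0" "g e2 e1 = 0"
    "g e1 x = 0" "g e2 x = 0" "g x e1 = 0" "g x e2 = 0" "g x x = curv M"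
    using e x
    by (auto simp: orthonormal_basis_def tangent_def g_def points_def sprod_commute[of _ e2 e1]
        sprod_commute[of _ x e1] sprod_commute[of _ x e2])
  have gne: "g e1 e1 \<noteq> 0" "g e2 e2 \<noteq> 0"
    using g by auto
  have indep: "independent {x, e1, e2}" and dist: "x \<noteq> e1" "x \<noteq> e2" "e1 \<noteq> e2"
  proof -
    show dist: "x \<noteq> e1" "x \<noteq> e2" "e1 \<noteq> e2"
      using g c gne by auto
    have "a = 0 \<and> b = 0 \<and> d = 0" if "a *\<^sub>R x + b *\<^sub>R e1 + d *\<^sub>R e2 = 0" for a b d
    proof -
      have "g (a *\<^sub>R x + b *\<^sub>R e1 + d *\<^sub>R e2) y = 0" for y
        unfolding that by (simp add: g_def)
      from this[of x] this[of e1] this[of e2] show ?thesis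
        using g gne c by (simp add: g_def)
    qed
    then have "\<forall>w\<in>{x, e1, e2}. u w = 0" if "(\<Sum>w\<in>{x, e1, e2}. u w *\<^sub>R w) = 0" for u
      using that dist by (auto simp: add.assoc)
    then show "independent {x, e1, e2}"
      by (subst independent_explicit) auto
  qed
  have "card {x, e1, e2} = 3"
    using dist by simp
  then have sp: "span {x, e1, e2} = UNIV"
    using indep card_eq_dim[of "{x, e1, e2}" UNIV] by (auto simp: dim_UNIV)
  define w where
    "w = v - ((g e1 e1 * g v e1) *\<^sub>R e1 + (g e2 e2 * g v e2) *\<^sub>R e2)"
  have w: "g w x = 0" "g w e1 = 0" "g w e2 = 0"
    using v g by (simp_all add: w_def g_def tangent_def)
  have "g w y = 0" for y
  proof -
    have "y \<in> span {x, e1, e2}"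
      using sp by simp
    then show ?thesis
      by (induction rule: span_induct_alt) (use w in \<open>auto simp: g_def\<close>)
  qed
  then have "w = 0"
    unfolding g_def by (rule sprod_nondegenerate)
  then show ?thesis
    by (simp add: w_def g_def)
qed

lemma metric_trace_bilinear:
  fixes B :: "real^3 \<Rightarrow> real^3 \<Rightarrow> 'b::real_vector"
  assumes x: "x \<in> points M" and e: "orthonormal_basis M x (e1, e2)" and B: "bilinear B"
  shows "metric_trace M x B = qmetric M e1 e1 *\<^sub>R B e1 e1 + qmetric M e2 e2 *\<^sub>R B e2 e2"
proof -
  define g where "g = qmetric M"
  obtain f1 f2 where S: "(SOME e. orthonormal_basis M x e) = (f1, f2)"
    by (cases "SOME e. orthonormal_basis M x e")
  then have f: "orthonormal_basis M x (f1, f2)"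
    using someI_ex[OF orthonormal_basis_exists[OF x]] by simp
  have te: "e1 \<in> tangent M x" "e2 \<in> tangent M x" and tf: "f1 \<in> tangent M x" "f2 \<in> tangent M x"
    using e f by (auto simp: orthonormal_basis_def)
  define a b c d where "a = g f1 e1" and "b = g f1 e2" and "c = g f2 e1" and "d = g f2 e2"
  define p q r s where "p = g e1 e1" and "q = g e2 e2" and "r = g f1 f1" and "s = g f2 f2"
  have sq: "p * p = 1" "q * q = 1"
    using e by (auto simp: orthonormal_basis_def p_def q_def g_def)
  have F: "f1 = (p * a) *\<^sub>R e1 + (q * b) *\<^sub>R e2" "f2 = (p * c) *\<^sub>R e1 + (q * d) *\<^sub>R e2"
    using orthonormal_expansion[OF x e tf(1)] orthonormal_expansion[OF x e tf(2)]
    by (simp_all add: p_def q_def a_def b_def c_def d_def g_def)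
  have E: "e1 = (r * a) *\<^sub>R f1 + (s * c) *\<^sub>R f2" "e2 = (r * b) *\<^sub>R f1 + (s * d) *\<^sub>R f2"
    using orthonormal_expansion[OF x f te(1)] orthonormal_expansion[OF x f te(2)]
    by (simp_all add: r_def s_def a_def b_def c_def d_def g_def sprod_commute)
  have "p = g ((r * a) *\<^sub>R f1 + (s * c) *\<^sub>R f2) e1"
    using E(1) p_def by simp
  then have 1: "r * a * a + s * c * c = p"
    by (simp add: g_def a_def c_def)
  have "0 = g ((r * a) *\<^sub>R f1 + (s * c) *\<^sub>R f2) e2"
    using E(1) e by (simp add: orthonormal_basis_def g_def)
  then have 2: "r * a * b + s * c * d = 0"
    by (simp add: g_def b_def d_def)
  have "q = g ((r * b) *\<^sub>R f1 + (s * d) *\<^sub>R f2) e2"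
    using E(2) q_def by simp
  then have 3: "r * b * b + s * d * d = q"
    by (simp add: g_def b_def d_def)
  note bl = bilinear_ladd[OF B] bilinear_radd[OF B] bilinear_lmul[OF B] bilinear_rmul[OF B]
  have X: "B f1 f1 = (p*a*(p*a)) *\<^sub>R B e1 e1 + (p*a*(q*b)) *\<^sub>R B e1 e2
      + (q*b*(p*a)) *\<^sub>R B e2 e1 + (q*b*(q*b)) *\<^sub>R B e2 e2"
    by (subst (1 2) F(1)) (simp add: bl algebra_simps)
  have Y: "B f2 f2 = (p*c*(p*c)) *\<^sub>R B e1 e1 + (p*c*(q*d)) *\<^sub>R B e1 e2
      + (q*d*(p*c)) *\<^sub>R B e2 e1 + (q*d*(q*d)) *\<^sub>R B e2 e2"
    by (subst (1 2) F(2)) (simp add: bl algebra_simps)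
  have "r *\<^sub>R B f1 f1 + s *\<^sub>R B f2 f2 =
      (r*(p*a*(p*a)) + s*(p*c*(p*c))) *\<^sub>R B e1 e1
    + (r*(p*a*(q*b)) + s*(p*c*(q*d))) *\<^sub>R B e1 e2
    + (r*(q*b*(p*a)) + s*(q*d*(p*c))) *\<^sub>R B e2 e1
    + (r*(q*b*(q*b)) + s*(q*d*(q*d))) *\<^sub>R B e2 e2"
    unfolding X Y by (simp add: scaleR_add_left scaleR_add_right)
  also have "r*(p*a*(p*a)) + s*(p*c*(p*c)) = p"
  proof -
    have "r*(p*a*(p*a)) + s*(p*c*(p*c)) = (p*p) * (r*a*a+s*c*c)"
      by (simp add: algebra_simps)
    then show ?thesis
      by (simp add: 1 sq)
  qed
  also have "r*(p*a*(q*b)) + s*(p*c*(q*d)) = 0"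
  proof -
    have "r*(p*a*(q*b)) + s*(p*c*(q*d)) = (p*q) * (r*a*b+s*c*d)"
      by (simp add: algebra_simps)
    then show ?thesis
      by (simp add: 2)
  qed
  also have "r*(q*b*(p*a)) + s*(q*d*(p*c)) = 0"
  proof -
    have "r*(q*b*(p*a)) + s*(q*d*(p*c)) = (p*q) * (r*a*b+s*c*d)"
      by (simp add: algebra_simps)
    then show ?thesis
      by (simp add: 2)
  qed
  also have "r*(q*b*(q*b)) + s*(q*d*(q*d)) = q"
  proof -
    have "r*(q*b*(q*b)) + s*(q*d*(q*d)) = (q*q) * (r*b*b+s*d*d)"
      by (simp add: algebra_simps)
    then show ?thesis
      by (simp add: 3 sq)
  qed
  finally show ?thesis
    by (simp add: metric_trace_def S r_def s_def p_def q_def g_def)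
qed

lemma metric_trace_eq:
  fixes B C :: "real^3 \<Rightarrow> real^3 \<Rightarrow> 'b::real_vector"
  assumes x: "x \<in> points M" and e: "orthonormal_basis M x (e1, e2)" and C: "bilinear C"
    and eq: "\<And>v w. v \<in> tangent M x \<Longrightarrow> w \<in> tangent M x \<Longrightarrow> B v w = C v w"
  shows "metric_trace M x B = qmetric M e1 e1 *\<^sub>R B e1 e1 + qmetric M e2 e2 *\<^sub>R B e2 e2"
proof -
  obtain f1 f2 where S: "(SOME e. orthonormal_basis M x e) = (f1, f2)"
    by (cases "SOME e. orthonormal_basis M x e")
  then have "orthonormal_basis M x (f1, f2)"
    using someI_ex[OF orthonormal_basis_exists[OF x]] by simp
  then have "f1 \<in> tangent M x" "f2 \<in> tangent M x"
    by (auto simp: orthonormal_basis_def)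
  then have "metric_trace M x B = metric_trace M x C"
    by (simp add: metric_trace_def S eq)
  then show ?thesis
    using metric_trace_bilinear[OF x e C] e by (simp add: orthonormal_basis_def eq)
qed

end

theory Submission
  imports Defs
begin

text \<open>
  Every skew-symmetric map of the ambient space is \<open>x \<mapsto> a \<times> x\<close> for the vector product
  \<open>vprod\<close> adapted to the indefinite inner product, so a Killing field is determined by
  one vector \<open>a\<close>. Write \<open>t = \<langle>a, x\<rangle>\<close>, let \<open>D\<close> be the product of the three coordinate signs and
  \<open>\<epsilon>\<close> the curvature. Then \<open>\<nabla>\<^sub>v \<sigma> = \<epsilon> t (x \<times> v)\<close>, and \<open>v \<mapsto> x \<times> v\<close> is a parallel field of
  tangent endomorphisms, so every ingredient of \<open>\<tau>\<close> can be computed from \<open>t\<close>. The gradient of the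
  energy is a multiple of the tangential part of \<open>a\<close>, and differentiating \<open>\<sigma>\<close> along that part gives
  a multiple of \<open>\<sigma>\<close> again. Thus \<open>\<tau>\<close> is a multiple of \<open>\<sigma>\<close>: with \<open>s = D t\<^sup>2\<close> and
  \<open>b = \<epsilon> D \<langle>a, a\<rangle>\<close>,
  \<open>\<tau>(\<sigma>) = \<epsilon> ((1 + b - s) (1 + q b - 3 q s) + p q s (b - s)) \<sigma>\<close>
  (\<open>tau_vprod_field\<close>).

  The field \<open>\<sigma>\<close> vanishes only where \<open>s = b\<close>, while for \<open>a \<noteq> 0\<close> the function \<open>s\<close> takes infinitely
  many values on the quadric (\<open>infinite_square_values\<close>). Hence \<open>\<sigma>\<close> is harmonic exactly if this
  quadratic polynomial in \<open>s\<close> is zero, and comparing coefficients leaves only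
  \<open>p = 3\<close>, \<open>q = -1/2\<close>, \<open>b = -1\<close> (\<open>tau_vprod_field_eq_0_iff\<close>). On the Riemannian sphere \<open>b = \<langle>a, a\<rangle>\<close>
  cannot be negative, which is why that quadric has to be left out.

  The condition \<open>b = -1\<close> prescribes \<open>\<langle>a, a\<rangle>\<close>. Two vectors with the same non-zero square are, up to
  sign, interchanged by a reflection, and linear isometries carry vector products to vector products up to
  the determinant; so all harmonic Killing fields are congruent (\<open>congruent_vprod_fields\<close>).
\<close>

section \<open>The vector product of an indefinite inner product\<close>

text \<open>The signs make \<open>\<langle>a \<times> b, c\<rangle>\<close> the ordinary determinant of \<open>a\<close>, \<open>b\<close>, \<open>c\<close>, whatever the index.\<close>

definition vprod :: "nat \<Rightarrow> real^3 \<Rightarrow> real^3 \<Rightarrow> real^3" where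
  "vprod u a b = vector
     [coord_sign u 1 * (a$2 * b$3 - a$3 * b$2),
      coord_sign u 2 * (a$3 * b$1 - a$1 * b$3),
      coord_sign u 3 * (a$1 * b$2 - a$2 * b$1)]"

definition det_sign :: "nat \<Rightarrow> real" where
  "det_sign u = coord_sign u 1 * coord_sign u 2 * coord_sign u 3"

lemma det_sign_sq [simp]: "det_sign u * det_sign u = 1"
  by (simp add: det_sign_def coord_sign_def)

lemma det_sign_nonzero [simp]: "det_sign u \<noteq> 0"
  using det_sign_sq[of u] by force

lemma curv_nonzero [simp]: "curv M \<noteq> 0"
  using curv_sq[of M] by force

lemma sign_cancel_left [simp]:
  "curv M * (curv M * r) = r" "det_sign u * (det_sign u * r) = r"
  by (simp_all flip: mult.assoc)

lemma vprod_nth [simp]: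
  "vprod u a b $ 1 = coord_sign u 1 * (a$2 * b$3 - a$3 * b$2)"
  "vprod u a b $ 2 = coord_sign u 2 * (a$3 * b$1 - a$1 * b$3)"
  "vprod u a b $ 3 = coord_sign u 3 * (a$1 * b$2 - a$2 * b$1)"
  by (simp_all add: vprod_def)

lemma bilinear_vprod: "bilinear (vprod u)"
  by (auto simp: bilinear_def vec_eq_iff forall_3 algebra_simps intro!: linearI)

lemma bounded_bilinear_vprod: "bounded_bilinear (vprod u)"
  using bilinear_vprod bilinear_conv_bounded_bilinear by blast

lemma vprod_simps [simp]:
  "vprod u (x + y) z = vprod u x z + vprod u y z"
  "vprod u z (x + y) = vprod u z x + vprod u z y"
  "vprod u (x - y) z = vprod u x z - vprod u y z"
  "vprod u z (x - y) = vprod u z x - vprod u z y"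
  "vprod u (r *\<^sub>R x) z = r *\<^sub>R vprod u x z"
  "vprod u z (r *\<^sub>R x) = r *\<^sub>R vprod u z x"
  "vprod u 0 z = 0" "vprod u z 0 = 0" "vprod u x x = 0"
  "vprod u (- x) z = - vprod u x z" "vprod u z (- x) = - vprod u z x"
  by (simp_all add: vec_eq_iff forall_3 algebra_simps)

lemma sprod_uminus [simp]: "sprod u (- x) z = - sprod u x z" "sprod u z (- x) = - sprod u z x"
  by (simp_all add: sprod_def)

lemma vprod_anticommute: "vprod u b a = - vprod u a b"
  by (simp add: vec_eq_iff forall_3 algebra_simps)

lemma sprod_vprod_cyclic: "sprod u (vprod u a b) c = sprod u a (vprod u b c)"
proof -
  have "coord_sign u 1 * coord_sign u 1 = 1" "coord_sign u 2 * coord_sign u 2 = 1"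
    "coord_sign u 3 * coord_sign u 3 = 1"
    by simp_all
  then show ?thesis
    unfolding sprod_def vprod_nth by algebra
qed

lemma sprod_vprod_self [simp]:
  "sprod u (vprod u a b) a = 0" "sprod u (vprod u a b) b = 0"
  "sprod u a (vprod u a b) = 0" "sprod u b (vprod u a b) = 0"
proof -
  show 2: "sprod u (vprod u a b) b = 0" for a b
    by (simp add: sprod_vprod_cyclic)
  show 1: "sprod u (vprod u a b) a = 0"
    using 2[of b a] by (simp add: vprod_anticommute[of u b a])
  show "sprod u a (vprod u a b) = 0" "sprod u b (vprod u a b) = 0"
    using 1 2[of a b] by (simp_all add: sprod_commute)
qed

text \<open>Lagrange's identity; the factor is the determinant of the Gram matrix of the standard basis.\<close>

lemma sprod_vprod_vprod:
  "sprod u (vprod u a b) (vprod u a c)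
     = det_sign u * (sprod u a a * sprod u b c - sprod u a b * sprod u a c)"
proof -
  have "coord_sign u 1 * coord_sign u 1 = 1" "coord_sign u 2 * coord_sign u 2 = 1"
    "coord_sign u 3 * coord_sign u 3 = 1"
    by simp_all
  then show ?thesis
    unfolding sprod_def vprod_nth det_sign_def by algebra
qed

text \<open>Cramer's rule in disguise: paired with a vector \<open>c\<close>, it is the expansion of \<open>n\<close> in terms of
  \<open>a\<close>, \<open>b\<close>, \<open>c\<close>, paired with \<open>n\<close>. With \<open>n\<close> normal to the
  quadric it gives tangential parts of vector products, and with \<open>n\<close> the axis of a reflection it
  gives the image of a vector product.\<close>

lemma vprod_expansion:
  "sprod u n n *\<^sub>R vprod u a b =
     sprod u b n *\<^sub>R vprod u a n + sprod u a n *\<^sub>R vprod u n b + sprod u (vprod u a b) n *\<^sub>R n"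
proof -
  have "coord_sign u 1 * coord_sign u 1 = 1" "coord_sign u 2 * coord_sign u 2 = 1"
    "coord_sign u 3 * coord_sign u 3 = 1"
    by simp_all
  then show ?thesis
    unfolding vec_eq_iff forall_3 sprod_def vprod_nth vector_add_component vector_scaleR_component
      real_scaleR_def
    by (intro conjI; algebra)
qed

text \<open>The three free entries of a skew-symmetric matrix are, up to sign, the coordinates of \<open>a\<close>.\<close>

lemma skew_symmetric_imp_vprod:
  assumes "skew_symmetric M A"
  obtains a where "\<And>x. A *v x = vprod (ambient_index M) a x"
proof
  define s where "s = coord_sign (ambient_index M)"
  define a :: "real^3" where "a = vector [s 3 * A$3$2, s 1 * A$1$3, s 2 * A$2$1]"
  have ss: "s 1 * s 1 = 1" "s 2 * s 2 = 1" "s 3 * s 3 = 1"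
    by (simp_all add: s_def)
  have sk: "qmetric M (A *v axis i 1) (axis j 1) = - qmetric M (axis i 1) (A *v axis j 1)" for i j
    using assms by (simp add: skew_symmetric_def)
  have e: "s 1 * A$1$1 = 0" "s 2 * A$2$2 = 0" "s 3 * A$3$3 = 0"
    "s 2 * A$2$1 = - (s 1 * A$1$2)" "s 3 * A$3$1 = - (s 1 * A$1$3)" "s 3 * A$3$2 = - (s 2 * A$2$3)"
    using sk[of 1 1] sk[of 2 2] sk[of 3 3] sk[of 1 2] sk[of 1 3] sk[of 2 3]
    by (simp_all add: sprod_def matrix_vector_mult_def sum_3 axis_def flip: s_def)
  show "A *v x = vprod (ambient_index M) a x" for x
    using ss e
    unfolding vec_eq_iff forall_3 vprod_nth matrix_vector_mult_def vec_lambda_beta sum_3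
      s_def[symmetric] a_def vector_3
    by (intro conjI; algebra)
qed

section \<open>Covariant derivatives of the field of a vector product\<close>

text \<open>Only the values on the quadric enter a derivative, so on the quadric a field may be replaced by
  any formula that can be differentiated in the ambient space.\<close>

lemma dir_deriv_cong:
  assumes x: "x \<in> points M" and v: "v \<in> tangent M x"
    and eq: "\<And>y. y \<in> points M \<Longrightarrow> f y = h y"
    and h: "(h has_derivative h') (at x within points M)"
  shows "dir_deriv M f x v = h' v"
  by (rule dir_deriv_eq[OF has_derivative_transform[OF x eq h] x v])

lemma tangent_vprod:
  "vprod (ambient_index M) a x \<in> tangent M x"
  by (simp add: tangent_def)

lemma tan_proj_simps [simp]:
  "tan_proj M x (v + w) = tan_proj M x v + tan_proj M x w"
  "tan_proj M x (v - w) = tan_proj M x v - tan_proj M x w"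
  "tan_proj M x (r *\<^sub>R v) = r *\<^sub>R tan_proj M x v"
  "tan_proj M x (- v) = - tan_proj M x v"
  "tan_proj M x 0 = 0"
  by (simp_all add: tan_proj_def algebra_simps)

lemma tan_proj_normal: "x \<in> points M \<Longrightarrow> tan_proj M x x = 0"
  by (simp add: tan_proj_def points_def)

text \<open>Split \<open>a\<close> into its normal part \<open>\<epsilon> \<langle>a, x\<rangle> x\<close> and its tangential part: the vector product of two
  tangent vectors is normal, so only the normal part of \<open>a\<close> contributes.\<close>

lemma tan_proj_vprod:
  assumes x: "x \<in> points M" and v: "v \<in> tangent M x"
  shows "tan_proj M x (vprod (ambient_index M) a v)
    = (curv M * qmetric M a x) *\<^sub>R vprod (ambient_index M) x v"
proof -
  define J where "J = vprod (ambient_index M)"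
  have "curv M *\<^sub>R J a v = qmetric M a x *\<^sub>R J x v + qmetric M (J a v) x *\<^sub>R x"
    using vprod_expansion[of "ambient_index M" x a v] x v
    by (simp add: points_def tangent_def J_def)
  then have "tan_proj M x (curv M *\<^sub>R J a v) = qmetric M a x *\<^sub>R tan_proj M x (J x v)"
    using tan_proj_normal[OF x] by simp
  also have "tan_proj M x (J x v) = J x v"
    by (simp add: tan_proj_def J_def)
  finally have "curv M *\<^sub>R curv M *\<^sub>R tan_proj M x (J a v) = (curv M * qmetric M a x) *\<^sub>R J x v"
    by simp
  then show ?thesis
    by (simp add: J_def)
qed

text \<open>This evaluates metric traces of forms that contain a factor \<open>\<langle>a, v\<rangle>\<close>.\<close>

lemma trace_tangential_part:
  assumes x: "x \<in> points M" and e: "orthonormal_basis M x (e1, e2)"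
  shows "(qmetric M e1 e1 * qmetric M a e1) *\<^sub>R e1 + (qmetric M e2 e2 * qmetric M a e2) *\<^sub>R e2
    = tan_proj M x a"
  using orthonormal_expansion[OF x e tan_proj_tangent[OF x, of a]] e
  by (simp add: orthonormal_basis_def metric_tan_proj)

lemma orthonormal_basisD:
  assumes "orthonormal_basis M x (e1, e2)"
  shows "qmetric M e1 e1 * qmetric M e1 e1 = 1" "qmetric M e2 e2 * qmetric M e2 e2 = 1"
    "e1 \<in> tangent M x" "e2 \<in> tangent M x"
  using assms by (auto simp: orthonormal_basis_def)

lemma grad_eqI:
  assumes x: "x \<in> points M" and g: "g \<in> tangent M x"
    and eq: "\<And>v. v \<in> tangent M x \<Longrightarrow> qmetric M g v = dir_deriv M f x v"
  shows "grad M f x = g"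
  unfolding grad_def
proof (rule the_equality)
  show "g \<in> tangent M x \<and> (\<forall>v\<in>tangent M x. qmetric M g v = dir_deriv M f x v)"
    using g eq by blast
next
  fix h assume h: "h \<in> tangent M x \<and> (\<forall>v\<in>tangent M x. qmetric M h v = dir_deriv M f x v)"
  obtain e1 e2 where e: "orthonormal_basis M x (e1, e2)"
    using orthonormal_basis_exists[OF x] by auto
  have "qmetric M h e1 = qmetric M g e1" "qmetric M h e2 = qmetric M g e2"
    using h eq orthonormal_basisD(3,4)[OF e] by auto
  then show "h = g"
    using orthonormal_expansion[OF x e, of h] orthonormal_expansion[OF x e g] h by metis
qed

context
  fixes M :: quadric and a :: "real^3" and \<sigma> :: "real^3 \<Rightarrow> real^3"
  assumes \<sigma>: "\<And>x. x \<in> points M \<Longrightarrow> \<sigma> x = vprod (ambient_index M) a x"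
begin

private abbreviation (input) "J \<equiv> vprod (ambient_index M)"
private abbreviation (input) "D \<equiv> det_sign (ambient_index M)"
private abbreviation (input) "t x \<equiv> qmetric M a x"

lemma cov_vprod_field:
  assumes x: "x \<in> points M" and v: "v \<in> tangent M x"
  shows "cov M \<sigma> x v = (curv M * t x) *\<^sub>R J x v"
proof -
  have "(J a has_derivative J a) (at x within points M)"
    by (rule bounded_linear_imp_has_derivative[OF
          bounded_bilinear.bounded_linear_right[OF bounded_bilinear_vprod]])
  then have "dir_deriv M \<sigma> x v = J a v"
    by (intro dir_deriv_cong[OF x v]) (use \<sigma> in auto)
  then show ?thesis
    by (simp add: cov_def tan_proj_vprod[OF x v])
qed

text \<open>In \<open>\<nabla>\<^sub>w \<sigma> = \<epsilon> \<langle>a, x\<rangle> (x \<times> w)\<close> only the scalar factor has a non-zero derivative: differentiating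
  \<open>x\<close> in \<open>x \<times> w\<close> produces the normal vector \<open>v \<times> w\<close>.\<close>

lemma cov2_vprod_field:
  assumes x: "x \<in> points M" and v: "v \<in> tangent M x" and w: "w \<in> tangent M x"
  shows "cov2 M \<sigma> x v w = (curv M * qmetric M a v) *\<^sub>R J x w"
proof -
  define W where "W = (\<lambda>y. tan_proj M y w)"
  \<comment> \<open>The extension of \<open>w\<close> used in the second derivative is parallel at \<open>x\<close>.\<close>
  have "(W has_derivative (\<lambda>v. - ((curv M * qmetric M w v) *\<^sub>R x))) (at x within points M)"
    unfolding W_def tan_proj_def
    by (rule derivative_eq_intros bounded_bilinear.FDERIV[OF bounded_bilinear_sprod] refl)+
      (use w in \<open>simp add: tangent_def\<close>)
  then have W: "cov M W x v = 0"
    by (simp add: cov_def dir_deriv_eq[OF _ x v] tan_proj_normal[OF x])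
  have "dir_deriv M (\<lambda>y. cov M \<sigma> y (W y)) x v
    = (curv M * t x) *\<^sub>R J v w + (curv M * qmetric M a v) *\<^sub>R J x w"
  proof (rule dir_deriv_cong[OF x v])
    show "cov M \<sigma> y (W y) = (curv M * t y) *\<^sub>R J y w" if y: "y \<in> points M" for y
      using cov_vprod_field[OF y tan_proj_tangent[OF y, of w]] by (simp add: W_def tan_proj_def)
    show "((\<lambda>y. (curv M * t y) *\<^sub>R J y w) has_derivative
      (\<lambda>v. (curv M * t x) *\<^sub>R J v w + (curv M * qmetric M a v) *\<^sub>R J x w)) (at x within points M)"
      by (rule derivative_eq_intros bounded_bilinear.FDERIV[OF bounded_bilinear_sprod]
          bounded_bilinear.FDERIV[OF bounded_bilinear_vprod] refl)+ simp
  qed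
  moreover have "tan_proj M x (J v w) = 0"
    using v by (simp add: tan_proj_vprod[OF x w] tangent_def)
  moreover have "tan_proj M x (J x w) = J x w"
    by (simp add: tan_proj_def)
  moreover have "cov M \<sigma> x 0 = 0"
    using cov_vprod_field[OF x, of 0] by (simp add: tangent_def)
  ultimately show ?thesis
    by (simp add: cov2_def cov_def[of M "\<lambda>y. cov M \<sigma> y (W y)"] W flip: W_def)
qed

text \<open>The trace of the second derivative is \<open>\<epsilon> x \<times> a\<close>, which is the case of Gaussian curvature \<open>\<epsilon>\<close> of
  the fact that the rough Laplacian of a Killing field is its Ricci image.\<close>

lemma rough_laplacian_vprod_field:
  assumes x: "x \<in> points M"
  shows "rough_laplacian M \<sigma> x = curv M *\<^sub>R J a x"
proof -
  obtain e1 e2 where e: "orthonormal_basis M x (e1, e2)"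
    using orthonormal_basis_exists[OF x] by auto
  let ?C = "\<lambda>v w. (curv M * qmetric M a v) *\<^sub>R J x w"
  have "bilinear ?C"
    by (auto simp: bilinear_def algebra_simps intro!: linearI)
  from metric_trace_eq[OF x e this, of "cov2 M \<sigma> x"]
  have "metric_trace M x (cov2 M \<sigma> x)
      = qmetric M e1 e1 *\<^sub>R ?C e1 e1 + qmetric M e2 e2 *\<^sub>R ?C e2 e2"
    using orthonormal_basisD[OF e] by (simp add: cov2_vprod_field[OF x])
  also have "\<dots> = curv M *\<^sub>R J x ((qmetric M e1 e1 * qmetric M a e1) *\<^sub>R e1
      + (qmetric M e2 e2 * qmetric M a e2) *\<^sub>R e2)"
    by (simp add: algebra_simps)
  also have "\<dots> = curv M *\<^sub>R J x a"
    unfolding trace_tangential_part[OF x e] by (simp add: tan_proj_def)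
  finally show ?thesis
    by (simp add: rough_laplacian_def vprod_anticommute[of _ x a])
qed

text \<open>By Lagrange's identity \<open>v \<mapsto> x \<times> v\<close> multiplies the metric of the tangent plane by \<open>\<epsilon> D\<close>,
  and the trace of the metric is 2.\<close>

lemma cov_norm2_vprod_field:
  assumes x: "x \<in> points M"
  shows "cov_norm2 M \<sigma> x = 2 * curv M * D * (t x)\<^sup>2"
proof -
  obtain e1 e2 where e: "orthonormal_basis M x (e1, e2)"
    using orthonormal_basis_exists[OF x] by auto
  have jj: "qmetric M (J x v) (J x v) = D * (curv M * qmetric M v v)" if "v \<in> tangent M x" for v
    using that x sprod_commute[of _ v x] by (simp add: sprod_vprod_vprod tangent_def points_def)
  let ?C = "\<lambda>v w. (t x)\<^sup>2 * qmetric M (J x v) (J x w)"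
  have C: "qmetric M (cov M \<sigma> x v) (cov M \<sigma> x w) = ?C v w"
    if "v \<in> tangent M x" "w \<in> tangent M x" for v w
    using that curv_sq[of M] by (simp add: cov_vprod_field[OF x] power2_eq_square)
  have "bilinear ?C"
    by (auto simp: bilinear_def algebra_simps intro!: linearI)
  from metric_trace_eq[OF x e this C]
  have "cov_norm2 M \<sigma> x = qmetric M e1 e1 * ?C e1 e1 + qmetric M e2 e2 * ?C e2 e2"
    unfolding cov_norm2_def using orthonormal_basisD(3,4)[OF e] C by simp
  also have "\<dots> = (t x)\<^sup>2 * (D * (curv M * (qmetric M e1 e1 * qmetric M e1 e1)
      + curv M * (qmetric M e2 e2 * qmetric M e2 e2)))"
    by (simp add: jj orthonormal_basisD(3,4)[OF e] algebra_simps)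
  finally show ?thesis
    by (simp add: orthonormal_basisD[OF e])
qed

lemma energy_vprod_field:
  assumes x: "x \<in> points M"
  shows "energy M \<sigma> x = D * (curv M * qmetric M a a - (t x)\<^sup>2) / 2"
  using x by (simp add: energy_def \<sigma> sprod_vprod_vprod points_def power2_eq_square algebra_simps)

lemma grad_energy_vprod_field:
  assumes x: "x \<in> points M"
  shows "grad M (energy M \<sigma>) x = - (D * t x) *\<^sub>R tan_proj M x a"
proof (rule grad_eqI[OF x])
  show "- (D * t x) *\<^sub>R tan_proj M x a \<in> tangent M x"
    using tan_proj_tangent[OF x, of a] by (simp add: tangent_def)
  fix v assume v: "v \<in> tangent M x"
  have "((\<lambda>y. D * (curv M * qmetric M a a - (t y)\<^sup>2) / 2) has_derivative
      (\<lambda>v. - (D * t x * qmetric M a v))) (at x within points M)"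
    by (rule derivative_eq_intros bounded_bilinear.FDERIV[OF bounded_bilinear_sprod] refl)+
      (auto simp: fun_eq_iff)
  from dir_deriv_cong[OF x v energy_vprod_field this]
  show "qmetric M (- (D * t x) *\<^sub>R tan_proj M x a) v = dir_deriv M (energy M \<sigma>) x v"
    by (simp add: metric_tan_proj[OF v])
qed

lemma norm_tan_proj:
  assumes x: "x \<in> points M"
  shows "qmetric M (tan_proj M x a) (tan_proj M x a) = qmetric M a a - curv M * (t x)\<^sup>2"
  using x curv_sq[of M]
  by (simp add: tan_proj_def points_def sprod_commute[of _ x a] power2_eq_square algebra_simps)

text \<open>The gradient of the energy is \<open>- D t\<close> times the tangential part \<open>a\<^sub>T\<close> of \<open>a\<close>. Here \<open>grad t = a\<^sub>T\<close>,
  and \<open>a\<^sub>T\<close> is a conformal field with \<open>\<nabla>\<^sub>v a\<^sub>T = - \<epsilon> t v\<close>. Both terms of the product rule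
  contribute to the divergence: the first one \<open>\<langle>a\<^sub>T, a\<^sub>T\<rangle>\<close>, the second one \<open>- 2 \<epsilon> t\<^sup>2\<close>.\<close>

lemma laplacian_energy_vprod_field:
  assumes x: "x \<in> points M"
  shows "laplacian M (energy M \<sigma>) x = D * (qmetric M a a - 3 * curv M * (t x)\<^sup>2)"
proof -
  obtain e1 e2 where e: "orthonormal_basis M x (e1, e2)"
    using orthonormal_basis_exists[OF x] by auto
  let ?X = "grad M (energy M \<sigma>)" and ?aT = "tan_proj M x a"
  have cX: "cov M ?X x v = - (D * qmetric M a v) *\<^sub>R ?aT + (D * curv M * (t x)\<^sup>2) *\<^sub>R v"
    if v: "v \<in> tangent M x" for v
  proof -
    have "((\<lambda>y. - (D * t y) *\<^sub>R (a - (curv M * t y) *\<^sub>R y)) has_derivative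
      (\<lambda>v. - (D * t x) *\<^sub>R (- (curv M * t x) *\<^sub>R v - (curv M * qmetric M a v) *\<^sub>R x)
         - (D * qmetric M a v) *\<^sub>R (a - (curv M * t x) *\<^sub>R x))) (at x within points M)"
      by (rule derivative_eq_intros bounded_bilinear.FDERIV[OF bounded_bilinear_sprod] refl)+ simp
    then have "dir_deriv M ?X x v
      = - (D * t x) *\<^sub>R (- (curv M * t x) *\<^sub>R v - (curv M * qmetric M a v) *\<^sub>R x)
         - (D * qmetric M a v) *\<^sub>R (a - (curv M * t x) *\<^sub>R x)"
      by (intro dir_deriv_cong[OF x v]) (simp_all add: grad_energy_vprod_field tan_proj_def)
    then show ?thesis
      unfolding cov_def
      by (simp only: tan_proj_simps tan_proj_normal[OF x] tan_proj_id[OF v])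
        (simp add: power2_eq_square mult_ac)
  qed
  let ?C = "\<lambda>v w. - (D * (qmetric M a v * qmetric M a w)) + D * curv M * (t x)\<^sup>2 * qmetric M v w"
  have C: "qmetric M (cov M ?X x v) w = ?C v w" if "v \<in> tangent M x" "w \<in> tangent M x" for v w
    using that by (simp add: cX metric_tan_proj)
  have "bilinear ?C"
    by (auto simp: bilinear_def algebra_simps intro!: linearI)
  from metric_trace_eq[OF x e this C]
  have "divergence M ?X x = qmetric M e1 e1 * ?C e1 e1 + qmetric M e2 e2 * ?C e2 e2"
    unfolding divergence_def using orthonormal_basisD(3,4)[OF e] C by simp
  also have "\<dots> = - (D * qmetric M a ((qmetric M e1 e1 * qmetric M a e1) *\<^sub>R e1
      + (qmetric M e2 e2 * qmetric M a e2) *\<^sub>R e2))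
      + D * curv M * (t x)\<^sup>2 * (qmetric M e1 e1 * qmetric M e1 e1 + qmetric M e2 e2 * qmetric M e2 e2)"
    by (simp add: algebra_simps)
  also have "\<dots> = - (D * (qmetric M a a - curv M * (t x)\<^sup>2)) + 2 * D * curv M * (t x)\<^sup>2"
    unfolding trace_tangential_part[OF x e]
    by (simp add: orthonormal_basisD[OF e] tan_proj_def power2_eq_square algebra_simps)
  finally show ?thesis
    by (simp add: laplacian_def algebra_simps)
qed

text \<open>The terms \<open>2 p \<nabla>\<^bsub>grad F\<^esub> \<sigma>\<close> and \<open>- p \<langle>\<nabla>\<sigma>, \<nabla>\<sigma>\<rangle> \<sigma>\<close> are \<open>2 p \<epsilon> s \<sigma>\<close> and \<open>- 2 p \<epsilon> s \<sigma>\<close>, so they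
  cancel, and \<open>p\<close> survives only together with \<open>q\<close>.\<close>

lemma tau_vprod_field:
  fixes p q :: real
  assumes x: "x \<in> points M"
  defines "b \<equiv> curv M * D * qmetric M a a" and "s \<equiv> D * (t x)\<^sup>2"
  shows "tau M p q \<sigma> x
    = (curv M * ((1 + b - s) * (1 + q * b - 3 * q * s) + p * q * s * (b - s))) *\<^sub>R J a x"
proof -
  let ?F = "energy M \<sigma>" and ?G = "grad M (energy M \<sigma>)"
  have F: "1 + 2 * ?F x = 1 + b - s"
    by (simp add: energy_vprod_field[OF x] b_def s_def field_simps)
  have G: "?G x \<in> tangent M x"
    using tan_proj_tangent[OF x, of a] by (simp add: grad_energy_vprod_field[OF x] tangent_def)
  have "J x (?G x) = - (D * t x) *\<^sub>R J x a"
    unfolding grad_energy_vprod_field[OF x] by (simp add: tan_proj_def)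
  then have cG: "cov M \<sigma> x (?G x) = (curv M * s) *\<^sub>R J a x"
    by (simp add: cov_vprod_field[OF x G] vprod_anticommute[of _ x a] s_def power2_eq_square mult_ac)
  have n: "cov_norm2 M \<sigma> x = 2 * curv M * s"
    by (simp add: cov_norm2_vprod_field[OF x] s_def)
  have GG: "qmetric M (?G x) (?G x) = curv M * (s * (b - s))"
    unfolding grad_energy_vprod_field[OF x] b_def s_def sprod_simps norm_tan_proj[OF x]
    by (simp add: power2_eq_square algebra_simps)
  have L: "laplacian M ?F x = curv M * (b - 3 * s)"
    unfolding laplacian_energy_vprod_field[OF x] b_def s_def
    by (simp add: algebra_simps)
  have "tau M p q \<sigma> x = ((1 + b - s) * curv M + 2 * p * (curv M * s)
      - (p * (2 * curv M * s) - p * q * (curv M * (s * (b - s)))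
         - q * (1 + b - s) * (curv M * (b - 3 * s)))) *\<^sub>R J a x"
    unfolding tau_def Let_def cG n GG L F rough_laplacian_vprod_field[OF x] \<sigma>[OF x]
    by (simp add: scaleR_add_left scaleR_diff_left)
  also have "(1 + b - s) * curv M + 2 * p * (curv M * s)
      - (p * (2 * curv M * s) - p * q * (curv M * (s * (b - s)))
         - q * (1 + b - s) * (curv M * (b - 3 * s)))
      = curv M * ((1 + b - s) * (1 + q * b - 3 * q * s) + p * q * s * (b - s))"
    by (simp add: algebra_simps)
  finally show ?thesis .
qed

end


section \<open>Determination of the harmonic fields\<close>

text \<open>If a function has only finitely many values on a quadric, it is constant along every continuous
  curve. The plane spanned by a point \<open>x\<close> and a unit tangent vector \<open>f\<close> meets the quadric in a circle
  or a hyperbola, and there \<open>\<langle>a, \<cdot>\<rangle>\<^sup>2\<close> can be constant only if \<open>a\<close> is orthogonal to \<open>x\<close> and to \<open>f\<close>.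
  An orthonormal pair of such vectors \<open>f\<close> leaves \<open>a = 0\<close>.\<close>

lemma infinite_square_values:
  assumes x: "x \<in> points M" and a: "a \<noteq> 0"
  shows "infinite ((\<lambda>y. (qmetric M a y)\<^sup>2) ` points M)"
proof
  assume fin: "finite ((\<lambda>y. (qmetric M a y)\<^sup>2) ` points M)"
  have zero: "qmetric M a x = 0 \<and> qmetric M a f = 0"
    if f: "f \<in> tangent M x" "qmetric M f f \<in> {1, -1}" for f
  proof -
    define \<eta> where "\<eta> = curv M * qmetric M f f"
    define c d where "c = qmetric M a x" and "d = qmetric M a f"
    have curv: "curv M = 1 \<or> curv M = -1"
      by (cases M) auto
    have \<eta>: "\<eta> = 1 \<or> \<eta> = -1"
      using f(2) curv by (auto simp: \<eta>_def)
    have ff: "qmetric M f f = curv M * \<eta>"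
      by (simp add: \<eta>_def)
    have fx: "qmetric M f x = 0" "qmetric M x f = 0" "qmetric M x x = curv M"
      using f(1) x by (simp_all add: tangent_def points_def sprod_commute[of _ x f])
    \<comment> \<open>The rational parametrization covers the circle (\<open>\<eta> = 1\<close>) and the hyperbola
      (\<open>\<eta> = -1\<close>) at once; the interval avoids the poles of the latter.\<close>
    define \<gamma> where "\<gamma> m = (1 / (1 + \<eta> * m\<^sup>2)) *\<^sub>R ((1 - \<eta> * m\<^sup>2) *\<^sub>R x + (2 * m) *\<^sub>R f)" for m :: real
    define h where "h m = ((c * (1 - \<eta> * m\<^sup>2) + 2 * d * m) / (1 + \<eta> * m\<^sup>2))\<^sup>2" for m :: real
    have nz: "1 + \<eta> * m\<^sup>2 \<noteq> 0" if "m \<in> {-1<..<1}" for m :: real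
    proof -
      have "m\<^sup>2 < 1"
        using that by (simp add: abs_square_less_1 abs_less_iff)
      moreover have "0 \<le> m\<^sup>2"
        by simp
      ultimately show ?thesis
        using \<eta> by (elim disjE; simp only:; linarith)
    qed
    have "\<gamma> m \<in> points M" if m: "m \<in> {-1<..<1}" for m
    proof -
      have "qmetric M (\<gamma> m) (\<gamma> m)
        = (1 / (1 + \<eta> * m\<^sup>2))\<^sup>2 * (curv M * ((1 - \<eta> * m\<^sup>2)\<^sup>2 + \<eta> * (2 * m)\<^sup>2))"
        by (simp add: \<gamma>_def fx ff power2_eq_square algebra_simps
            del: times_divide_eq_left times_divide_eq_right)
      also have "(1 - \<eta> * m\<^sup>2)\<^sup>2 + \<eta> * (2 * m)\<^sup>2 = (1 + \<eta> * m\<^sup>2)\<^sup>2"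
        by (simp add: power2_eq_square algebra_simps)
      finally show ?thesis
        using nz[OF m] by (simp add: points_def power_divide)
    qed
    moreover have "(qmetric M a (\<gamma> m))\<^sup>2 = h m" for m
      by (simp add: \<gamma>_def h_def c_def d_def mult_ac)
    ultimately have "h ` {-1<..<1} \<subseteq> (\<lambda>y. (qmetric M a y)\<^sup>2) ` points M"
      by (metis (no_types, lifting) image_eqI image_subsetI)
    then have "finite (h ` {-1<..<1})"
      using fin finite_subset by blast
    moreover have "connected (h ` {-1<..<1})"
      unfolding h_def using nz by (intro connected_continuous_image continuous_intros) auto
    ultimately obtain k where k: "h ` {-1<..<1} = {k}"
      using connected_finite_iff_sing[of "h ` {-1<..<1}"] by auto
    have hk: "h m = k" if "m \<in> {-1<..<1}" for m
      using k that by blast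
    have h0: "h 0 = c\<^sup>2"
      by (simp add: h_def)
    have ne: "4 + \<eta> \<noteq> 0"
      using \<eta> by auto
    \<comment> \<open>The parameters \<open>0\<close> and \<open>\<plusminus>1/2\<close> suffice to determine \<open>c\<close> and \<open>d\<close>.\<close>
    have sq: "(c * (4 - \<eta>) + 4 * r * d)\<^sup>2 = (c * (4 + \<eta>))\<^sup>2" if r: "r = 1 \<or> r = -1" for r
    proof -
      have "(c * (1 - \<eta> * (r / 2)\<^sup>2) + 2 * d * (r / 2)) / (1 + \<eta> * (r / 2)\<^sup>2)
        = (c * (4 - \<eta>) + 4 * r * d) / (4 + \<eta>)"
        using r ne by (auto simp: power2_eq_square field_simps)
      then have "h (r / 2) = ((c * (4 - \<eta>) + 4 * r * d) / (4 + \<eta>))\<^sup>2"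
        by (simp only: h_def)
      moreover have "h (r / 2) = h 0"
        using hk[of 0] hk[of "r / 2"] r by auto
      ultimately show ?thesis
        using ne by (simp add: h0 power_divide power_mult_distrib divide_eq_eq)
    qed
    have "c * d * (4 - \<eta>) = 0" and d2: "d\<^sup>2 = \<eta> * c\<^sup>2"
      using sq[of 1, simplified] sq[of "-1", simplified] by algebra+
    then have "c * d = 0"
      using \<eta> by auto
    then have "c = 0 \<and> d = 0"
      using d2 \<eta> by auto
    then show ?thesis
      by (simp add: c_def d_def)
  qed
  obtain e1 e2 where e: "orthonormal_basis M x (e1, e2)"
    using orthonormal_basis_exists[OF x] by auto
  have "qmetric M a x = 0" "qmetric M a e1 = 0" "qmetric M a e2 = 0"
    using zero[of e1] zero[of e2] e by (auto simp: orthonormal_basis_def)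
  then have "a = 0"
    using trace_tangential_part[OF x e, of a] by (simp add: tan_proj_def)
  then show False
    using a by simp
qed

text \<open>The factor of \<open>\<sigma>\<close> in \<open>\<tau>\<close> is a polynomial of degree 2 in \<open>s\<close> with infinitely many roots, so its
  coefficients vanish. The leading one gives \<open>q = 0\<close> or \<open>p = 3\<close>; the linear one is \<open>-1\<close> if \<open>q = 0\<close> and
  otherwise reads \<open>1 + q b = - 3 q\<close>; the constant one \<open>(1 + b) (1 + q b)\<close> then forces \<open>b = -1\<close>.\<close>

lemma tau_vprod_field_eq_0_iff:
  fixes p q :: real
  assumes \<sigma>: "\<And>x. x \<in> points M \<Longrightarrow> \<sigma> x = vprod (ambient_index M) a x"
    and nt: "nontrivial M \<sigma>"
  shows "(\<forall>x\<in>points M. tau M p q \<sigma> x = 0)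
    \<longleftrightarrow> p = 3 \<and> q = -1/2 \<and> curv M * det_sign (ambient_index M) * qmetric M a a = -1"
proof
  define D where "D = det_sign (ambient_index M)"
  define b where "b = curv M * D * qmetric M a a"
  define P where "P s = (1 + b - s) * (1 + q * b - 3 * q * s) + p * q * s * (b - s)" for s
  have tau: "tau M p q \<sigma> x
      = (curv M * P (D * (qmetric M a x)\<^sup>2)) *\<^sub>R vprod (ambient_index M) a x"
    if "x \<in> points M" for x
    unfolding P_def b_def D_def by (rule tau_vprod_field[OF \<sigma> that])
  {
    assume "p = 3 \<and> q = -1/2 \<and> curv M * det_sign (ambient_index M) * qmetric M a a = -1"
    then have "p = 3" "1 + 2 * q = 0" "b = -1"
      by (simp_all add: b_def D_def)
    moreover from this(1,3) have "P s = - s * (1 + 2 * q)" for s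
      by (simp add: P_def algebra_simps)
    ultimately have "P s = 0" for s
      by simp
    then show "\<forall>x\<in>points M. tau M p q \<sigma> x = 0"
      by (simp add: tau)
  }
  assume harm: "\<forall>x\<in>points M. tau M p q \<sigma> x = 0"
  obtain x0 where x0: "x0 \<in> points M" and "vprod (ambient_index M) a x0 \<noteq> 0"
    using nt by (auto simp: nontrivial_def \<sigma>)
  then have a: "a \<noteq> 0"
    by auto
  define S where "S = (\<lambda>x. D * (qmetric M a x)\<^sup>2) ` points M"
  \<comment> \<open>At a zero of the field \<open>\<tau>\<close> gives no information, but such a point has \<open>s = b\<close>, since
    \<open>b - s\<close> is the square of the field.\<close>
  have "P s = 0" if s: "s \<in> S - {b}" for s
  proof -
    obtain x where x: "x \<in> points M" and sx: "s = D * (qmetric M a x)\<^sup>2"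
      using s by (auto simp: S_def)
    have "qmetric M (vprod (ambient_index M) a x) (vprod (ambient_index M) a x) = b - s"
      using x by (simp add: sprod_vprod_vprod points_def b_def sx D_def power2_eq_square algebra_simps)
    then have "vprod (ambient_index M) a x \<noteq> 0"
      using s by auto
    then show ?thesis
      using harm tau[OF x] x by (simp add: sx)
  qed
  moreover have "infinite S"
  proof -
    have "S = (*) D ` (\<lambda>x. (qmetric M a x)\<^sup>2) ` points M"
      by (simp add: S_def image_image)
    moreover have "inj_on ((*) D) A" for A
      by (simp add: inj_on_def D_def)
    ultimately show ?thesis
      using infinite_square_values[OF x0 a] by (simp add: finite_image_iff)
  qed
  \<comment> \<open>The coefficients of \<open>P\<close>.\<close>
  moreover define P' where
    "P' = [:(1 + b) * (1 + q * b), p * q * b - 3 * q * (1 + b) - (1 + q * b), 3 * q - p * q:]"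
  have "poly P' s = P s" for s
    by (simp add: P'_def P_def algebra_simps)
  ultimately have "infinite {s. poly P' s = 0}"
    by (metis (mono_tags, lifting) finite_Diff2 finite.emptyI finite.insertI finite_subset
        mem_Collect_eq subsetI)
  then have "P' = 0"
    using poly_roots_finite by blast
  then have e: "(1 + b) * (1 + q * b) = 0" "p * q * b - 3 * q * (1 + b) - (1 + q * b) = 0"
    "3 * q - p * q = 0"
    by (simp_all add: P'_def)
  have "q \<noteq> 0"
    using e(2) by auto
  then have p: "p = 3"
    using e(3) by simp
  have q: "1 + q * b = - (3 * q)"
    using e(2) unfolding p by (simp add: algebra_simps)
  then have "b = -1"
    using e(1) \<open>q \<noteq> 0\<close> by (simp add: add_eq_0_iff)
  with p q show "p = 3 \<and> q = -1/2 \<and> curv M * det_sign (ambient_index M) * qmetric M a a = -1"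
    by (simp add: b_def D_def)
qed

section \<open>Congruence by reflections\<close>

lemma Ck_on_const: "Ck_on k (\<lambda>x. c) U"
  by (induction k arbitrary: c) auto

lemma Ck_on_linear:
  assumes "linear f"
  shows "Ck_on k f UNIV"
proof (cases k)
  case 0
  then show ?thesis
    using assms by (simp add: linear_continuous_on linear_conv_bounded_linear)
next
  case (Suc n)
  have D: "(f has_derivative f) (at x)" for x
    using assms by (intro bounded_linear_imp_has_derivative) (simp add: linear_conv_bounded_linear)
  then have "frechet_derivative f (at x) = f" for x
    using frechet_derivative_at by metis
  then show ?thesis
    using D by (auto simp: Suc Ck_on_const differentiable_on_def differentiable_def)
qed

text \<open>The map \<open>f\<close> may differ from \<open>g\<close> off the quadric; this is needed for the inverse of an isometry,
  which is arbitrary there.\<close>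

lemma smooth_on_quadric_linear:
  assumes "linear g" and "\<And>y. y \<in> points M \<Longrightarrow> g y = f y"
  shows "smooth_on_quadric M f"
  unfolding smooth_on_quadric_def using assms Ck_on_linear[OF assms(1)]
  by (intro ballI exI[of _ UNIV] exI[of _ g]) auto

lemma congruent_fields_linear:
  assumes lin: "linear \<Phi>" "linear \<Psi>"
    and inv: "\<And>x. \<Phi> (\<Psi> x) = x" "\<And>x. \<Psi> (\<Phi> x) = x"
    and iso: "\<And>v w. qmetric M (\<Phi> v) (\<Phi> w) = qmetric M v w"
    and \<sigma>: "\<And>x. x \<in> points M \<Longrightarrow> \<sigma> x \<in> tangent M x"
    and \<sigma>': "\<And>x. x \<in> points M \<Longrightarrow> \<sigma>' x = \<Phi> (\<sigma> (\<Psi> x))"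
  shows "congruent_fields M \<sigma> \<sigma>'"
proof -
  have P: "\<Phi> x \<in> points M \<longleftrightarrow> x \<in> points M" for x
    by (simp add: points_def iso)
  have Q: "\<Psi> x \<in> points M" if "x \<in> points M" for x
    using P[of "\<Psi> x"] that by (simp add: inv)
  have bij: "bij_betw \<Phi> (points M) (points M)"
    by (rule bij_betwI[where g = \<Psi>]) (auto simp: inv P Q)
  have inv_into: "inv_into (points M) \<Phi> y = \<Psi> y" if "y \<in> points M" for y
    using that by (intro inv_into_f_eq bij_betw_imp_inj_on[OF bij] Q inv)
  have "(\<Phi> has_derivative \<Phi>) (at x within points M)" for x
    using lin(1) by (intro bounded_linear_imp_has_derivative) (simp add: linear_conv_bounded_linear)
  then have dir: "dir_deriv M \<Phi> x v = \<Phi> v" if "x \<in> points M" "v \<in> tangent M x" for x v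
    using that by (intro dir_deriv_eq)
  have "isometry M \<Phi>"
    unfolding isometry_def
    using bij smooth_on_quadric_linear[OF lin(1)] smooth_on_quadric_linear[OF lin(2)]
    by (auto simp: inv_into dir iso)
  moreover have "\<sigma>' x = push_forward M \<Phi> \<sigma> x" if "x \<in> points M" for x
    by (simp add: push_forward_def inv_into[OF that] dir[OF Q[OF that] \<sigma>[OF Q[OF that]]] \<sigma>'[OF that])
  ultimately show ?thesis
    unfolding congruent_fields_def by blast
qed

definition reflection :: "nat \<Rightarrow> real^3 \<Rightarrow> real^3 \<Rightarrow> real^3" where
  "reflection u n x = x - (2 * sprod u x n / sprod u n n) *\<^sub>R n"

lemma linear_reflection: "linear (reflection u n)"
  by (rule linearI) (simp_all add: reflection_def algebra_simps add_divide_distrib)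

lemma reflection_involution:
  assumes "sprod u n n \<noteq> 0"
  shows "reflection u n (reflection u n x) = x"
  using assms by (simp add: reflection_def algebra_simps flip: scaleR_add_left)

lemma sprod_reflection:
  assumes "sprod u n n \<noteq> 0"
  shows "sprod u (reflection u n x) (reflection u n y) = sprod u x y"
  using assms by (simp add: reflection_def sprod_commute[of u n y] field_simps)

text \<open>A linear isometry carries vector products to vector products up to its determinant, here \<open>-1\<close>.\<close>

lemma reflection_vprod:
  assumes n: "sprod u n n \<noteq> 0"
  shows "reflection u n (vprod u a b) = - vprod u (reflection u n a) (reflection u n b)"
proof -
  define N where "N = sprod u n n"
  have "(2 / N) *\<^sub>R (N *\<^sub>R vprod u a b) = (2 / N) *\<^sub>R (sprod u b n *\<^sub>R vprod u a n
      + sprod u a n *\<^sub>R vprod u n b + sprod u (vprod u a b) n *\<^sub>R n)"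
    by (simp only: vprod_expansion N_def)
  then have "vprod u a b + vprod u a b = (2 * sprod u b n / N) *\<^sub>R vprod u a n
      + (2 * sprod u a n / N) *\<^sub>R vprod u n b + (2 * sprod u (vprod u a b) n / N) *\<^sub>R n"
    using n by (simp add: scaleR_add_right scaleR_2 flip: N_def)
  then show ?thesis
    by (simp add: reflection_def eq_neg_iff_add_eq_0 flip: N_def)
qed

lemma reflection_orthogonal: "sprod u x n = 0 \<Longrightarrow> reflection u n x = x"
  by (simp add: reflection_def)

lemma reflection_diff:
  assumes "sprod u a a = sprod u b b" and "sprod u (a - b) (a - b) \<noteq> 0"
  shows "reflection u (a - b) a = b"
proof -
  have "2 * sprod u a (a - b) = sprod u (a - b) (a - b)"
    using assms(1) by (simp add: sprod_commute[of u b a])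
  then show ?thesis
    using assms(2) by (simp add: reflection_def)
qed

text \<open>A reflection reverses vector products, so it transports the field of \<open>a\<close> to the field of \<open>b\<close> if it
  maps \<open>a\<close> to \<open>-b\<close>; the reflection along \<open>a + b\<close> does so unless \<open>a + b\<close> is null. Since \<open>a + b\<close> and
  \<open>a - b\<close> have squares adding up to \<open>4 \<langle>a, a\<rangle> \<noteq> 0\<close>, in that case the reflection along \<open>a - b\<close> exists and
  maps \<open>a\<close> to \<open>b\<close>. The sign is repaired by composing it with the reflection along a vector \<open>k\<close>
  orthogonal to \<open>a\<close>, which fixes \<open>a\<close>.\<close>

lemma congruent_vprod_fields:
  assumes \<sigma>: "\<And>x. x \<in> points M \<Longrightarrow> \<sigma> x = vprod (ambient_index M) a x"
    and \<sigma>': "\<And>x. x \<in> points M \<Longrightarrow> \<sigma>' x = vprod (ambient_index M) b x"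
    and ab: "qmetric M a a = qmetric M b b" "qmetric M a a \<noteq> 0"
    and k: "qmetric M k k \<noteq> 0" "qmetric M a k = 0"
  shows "congruent_fields M \<sigma> \<sigma>'"
proof -
  let ?u = "ambient_index M"
  let ?R = "reflection ?u"
  have P: "?R n x \<in> points M" if "x \<in> points M" "qmetric M n n \<noteq> 0" for x n
    using that by (simp add: points_def sprod_reflection)
  have tan: "\<sigma> x \<in> tangent M x" if "x \<in> points M" for x
    using that by (simp add: \<sigma> tangent_vprod)
  show ?thesis
  proof (cases "qmetric M (a + b) (a + b) = 0")
    case False
    then have n: "qmetric M (a - - b) (a - - b) \<noteq> 0"
      by simp
    have ra: "?R (a - - b) a = - b"
      using n ab(1) by (intro reflection_diff) simp_all
    show ?thesis
    proof (rule congruent_fields_linear[where \<Phi> = "?R (a - - b)" and \<Psi> = "?R (a - - b)"])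
      show "\<sigma>' x = ?R (a - - b) (\<sigma> (?R (a - - b) x))" if x: "x \<in> points M" for x
        unfolding \<sigma>'[OF x] \<sigma>[OF P[OF x n]] reflection_vprod[OF n] reflection_involution[OF n] ra
        by simp
    qed (use n tan in \<open>simp_all only: linear_reflection reflection_involution sprod_reflection not_False_eq_True\<close>)
  next
    case True
    have "qmetric M (a + b) (a + b) + qmetric M (a - b) (a - b) = 4 * qmetric M a a"
      using ab(1) by simp
    then have n: "qmetric M (a - b) (a - b) \<noteq> 0"
      using True ab(2) by linarith
    have ra: "?R (a - b) (?R k a) = b"
      by (simp only: reflection_orthogonal[OF k(2)] reflection_diff[OF ab(1) n])
    show ?thesis
    proof (rule congruent_fields_linear[where \<Phi> = "\<lambda>x. ?R (a - b) (?R k x)"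
          and \<Psi> = "\<lambda>x. ?R k (?R (a - b) x)"])
      show "linear (\<lambda>x. ?R (a - b) (?R k x))" "linear (\<lambda>x. ?R k (?R (a - b) x))"
        using linear_compose[OF linear_reflection linear_reflection] by (simp_all add: o_def)
      show "\<sigma>' x = ?R (a - b) (?R k (\<sigma> (?R k (?R (a - b) x))))" if x: "x \<in> points M" for x
      proof -
        have "?R (a - b) (?R k (vprod ?u a (?R k (?R (a - b) x)))) = vprod ?u b x"
          unfolding reflection_vprod[OF k(1)] reflection_involution[OF k(1)]
            linear_neg[OF linear_reflection] reflection_vprod[OF n] reflection_involution[OF n] ra
          by simp
        then show ?thesis
          by (simp only: \<sigma>'[OF x] \<sigma>[OF P[OF P[OF x n] k(1)]])
      qed
    qed (use n k(1) tan in \<open>simp_all only: reflection_involution sprod_reflection not_False_eq_True\<close>)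
  qed
qed

section \<open>Harmonic Killing fields on the quadrics\<close>

lemma killing_field_vprod:
  assumes A: "\<And>x. A *v x = vprod (ambient_index M) a x"
  shows "killing_field M (\<lambda>x. A *v x)"
proof -
  let ?u = "ambient_index M"
  have skew: "sprod ?u (vprod ?u c v) w = - sprod ?u v (vprod ?u c w)" for c v w
    using vprod_anticommute[of ?u v w]
    by (simp add: sprod_vprod_cyclic sprod_commute[of ?u v "vprod ?u c w"])
  have "skew_symmetric M A"
    unfolding skew_symmetric_def A by (intro allI skew)
  moreover have "vector_field M (\<lambda>x. A *v x)"
    unfolding vector_field_def
    using smooth_on_quadric_linear[OF matrix_vector_mul_linear] tangent_vprod by (auto simp: A)
  moreover have "qmetric M (cov M (\<lambda>x. A *v x) x v) w + qmetric M v (cov M (\<lambda>x. A *v x) x w) = 0"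
    if "x \<in> points M" "v \<in> tangent M x" "w \<in> tangent M x" for x v w
    using that skew[of x v w] by (simp add: cov_vprod_field[OF A])
  ultimately show ?thesis
    unfolding killing_field_def by blast
qed

text \<open>The model field is a vector product with a unit vector along the first axis for \<open>S2 1\<close> and \<open>H2 1\<close>,
  and along the third one otherwise. The second axis is orthogonal to both, so it can serve as the
  auxiliary vector in \<open>congruent_vprod_fields\<close>.\<close>

lemma model_matrix_vprod:
  assumes "M \<in> {S2 1, S2 2, H2 0, H2 1, H2 2}"
  obtains a where "\<And>x. model_matrix M *v x = vprod (ambient_index M) a x"
    and "curv M * det_sign (ambient_index M) * qmetric M a a = -1"
    and "qmetric M a (axis 2 1) = 0"
    and "nontrivial M (\<lambda>x. model_matrix M *v x)"
proof -
  define a :: "real^3" where "a = (if M = S2 1 then vector [-1, 0, 0] else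
    if M = H2 1 then vector [1, 0, 0] else if M = H2 2 then vector [0, 0, 1] else vector [0, 0, -1])"
  define x :: "real^3" where "x = (if M = S2 1 \<or> M = H2 1 then vector [0, 1, 0]
    else if M = H2 0 then vector [3/4, 0, 5/4] else vector [1, 0, 0])"
  show thesis
  proof (rule that)
    show eq: "model_matrix M *v y = vprod (ambient_index M) a y" for y
      using assms
      by (auto simp: model_matrix_def a_def vec_eq_iff forall_3 matrix_vector_mult_def sum_3
          coord_sign_def)
    show "curv M * det_sign (ambient_index M) * qmetric M a a = -1"
      using assms by (auto simp: a_def sprod_def det_sign_def coord_sign_def)
    show "qmetric M a (axis 2 1) = 0"
      using assms by (auto simp: a_def sprod_def axis_def)
    have "x \<in> points M" "vprod (ambient_index M) a x \<noteq> 0"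
      using assms
      by (auto simp: x_def a_def points_def sprod_def coord_sign_def vec_eq_iff forall_3)
    then show "nontrivial M (\<lambda>x. model_matrix M *v x)"
      by (auto simp: nontrivial_def eq)
  qed
qed

theorem theorem7p5:
  fixes M :: quadric and \<sigma> :: "real^3 \<Rightarrow> real^3"
  assumes "M \<in> {S2 1, S2 2, H2 0, H2 1, H2 2}"
    and "\<sigma> = (\<lambda>x. model_matrix M *v x)"
  shows "killing_field M \<sigma> \<and> nontrivial M \<sigma> \<and> harmonic_field M \<sigma> \<and>
    (\<forall>\<sigma>'. killing_field M \<sigma>' \<and> nontrivial M \<sigma>' \<and> harmonic_field M \<sigma>'
        \<longrightarrow> congruent_fields M \<sigma> \<sigma>') \<and>
    metric_parameters M \<sigma> = {(3, -1/2)}"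
proof -
  obtain a where a: "\<And>x. model_matrix M *v x = vprod (ambient_index M) a x"
    and norm_a: "curv M * det_sign (ambient_index M) * qmetric M a a = -1"
    and orth: "qmetric M a (axis 2 1) = 0"
    and nt: "nontrivial M \<sigma>"
    using model_matrix_vprod[OF assms(1)] unfolding assms(2) by blast
  have \<sigma>: "\<sigma> x = vprod (ambient_index M) a x" for x
    by (simp add: assms(2) a)
  have killing: "killing_field M \<sigma>"
    unfolding assms(2) using a by (rule killing_field_vprod)
  then have params: "metric_parameters M \<sigma> = {(3, -1/2)}"
    using tau_vprod_field_eq_0_iff[OF \<sigma> nt] norm_a
    by (auto simp: metric_parameters_def pq_harmonic_def killing_field_def)
  then have "harmonic_field M \<sigma>"
    unfolding harmonic_field_def metric_parameters_def by blast
  moreover have "congruent_fields M \<sigma> \<sigma>'"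
    if killing': "killing_field M \<sigma>'" and nt': "nontrivial M \<sigma>'" and harm: "harmonic_field M \<sigma>'" for \<sigma>'
  proof -
    obtain A where "skew_symmetric M A" and A: "\<And>x. x \<in> points M \<Longrightarrow> \<sigma>' x = A *v x"
      using killing' unfolding killing_field_def by blast
    then obtain b where b: "\<And>x. x \<in> points M \<Longrightarrow> \<sigma>' x = vprod (ambient_index M) b x"
      using skew_symmetric_imp_vprod by metis
    have "curv M * det_sign (ambient_index M) * qmetric M b b = -1"
      using harm tau_vprod_field_eq_0_iff[OF b nt']
      by (auto simp: harmonic_field_def pq_harmonic_def)
    then have "curv M * det_sign (ambient_index M) * qmetric M a a
        = curv M * det_sign (ambient_index M) * qmetric M b b"
      using norm_a by simp
    then have "qmetric M a a = qmetric M b b"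
      by simp
    moreover have "qmetric M a a \<noteq> 0"
      using norm_a by auto
    moreover have "qmetric M (axis 2 1) (axis 2 1) \<noteq> 0"
      by (simp add: sprod_def axis_def coord_sign_def)
    ultimately show ?thesis
      using orth by (intro congruent_vprod_fields[OF \<sigma> b]) auto
  qed
  ultimately show ?thesis
    using killing nt params by blast
qed

end
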